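(* Let $d\ge 2$, let $\Omega=(0,1)^d$ be endowed with the uniform probability measure, and let $f:\Omega\to\mathbb{R}$ be a square-integrable bounded function with continuous second-order partial derivatives and variance $\sigma^2=\mathrm{Var}(f)>0$, such that all entries of the matrix $\mathbf{C}_{\rm gas}$ are well-defined (finite). Then for every $m$ with $1\le m\le d-1$ and every $i=1,\ldots,d$, $$\bar S_i\le \frac12\,\frac{\gamma_i(m)+\lambda_{m+1}}{\sigma^2},$$ where $\bar S_i$ is the upper Sobol' index of the $i$th input, $\gamma_i(m)$ is the global activity score of the $i$th parameter, and $\lambda_{m+1}$ is the $(m+1)$th eigenvalue (in descending order) of $\mathbf C_{\rm gas}$.
   Context: Notation: for $\mathbf v,\mathbf z\in\mathbb{R}^d$, $(\mathbf v_{\{i\}}{:}\mathbf z_{-\{i\}})$ is the vector whose $i$th component is $v_i$ and whose $j$th component is $z_j$ for $j\ne i$. Upper Sobol' index: let $f(\mathbf x)=\sum_{u\subseteq\{1,\ldots,d\}}f_u(\mathbf x)$ be the ANOVA decomposition of $f$ on $(0,1)^d$ with the uniform measure ($f_\emptyset=\int f\,d\mathbf x$ and, inductively, $f_u$ is the integral of $f$ over the variables not in $u$ minus $\sum_{v\subsetneq u}f_v$), let $\sigma_u^2$ be the variance of $f_u$, and $\sigma^2=\mathrm{Var}(f)=\sum_u\sigma_u^2$. Then $\bar S_i=\frac1{\sigma^2}\sum_{u\ni i}\sigma_u^2$; equivalently (known formula of Sobol') $$\bar S_i=\frac{1}{2\sigma^2}\int \big(f(\mathbf z)-f(\mathbf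 v_{\{i\}}{:}\mathbf z_{-\{i\}})\big)^2\,d\mathbf z\,dv_i .$$ Global activity scores: let $\mathbf v,\mathbf z$ be independent random vectors, both uniformly distributed on $\Omega$. Define $$D_{\mathbf z,i}f(v_i,\mathbf z)=\frac{f(\mathbf v_{\{i\}}{:}\mathbf z_{-\{i\}})-f(\mathbf z)}{v_i-z_i},\qquad D_{\mathbf z}f(\mathbf v,\mathbf z)=[D_{\mathbf z,1}f(v_1,\mathbf z),\ldots,D_{\mathbf z,d}f(v_d,\mathbf z)]^T,$$ (defined almost surely), and the $d\times d$ symmetric positive semidefinite matrix $$\mathbf C_{\rm gas}=\mathbb{E}\big[\mathbb{E}[(D_{\mathbf z}f)(D_{\mathbf z}f)^T\mid \mathbf z]\big].$$ Let $\mathbf C_{\rm gas}=\mathbf U\Lambda\mathbf U^T$ be an eigenvalue decomposition, with $\mathbf U=[\mathbf u_1,\ldots,\mathbf u_d]$ orthogonal, $\mathbf u_j=[u_{1j},\ldots,u_{dj}]^T$, and $\Lambda=\mathrm{diag}(\lambda_1,\ldots,\lambda_d)$, $\lambda_1\ge\cdots\ge\lambda_d\ge0$. For $m\le d$ the global activity score of the $i$th parameter is $\gamma_i(m)=\sum_{j=1}^m\lambda_j u_{ij}^2$. *)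

theory Defs
  imports "HOL-Probability.Probability"
begin

definition open_cube :: "(real ^ 'n) set" where
  "open_cube = {x. \<forall>i. 0 < x $ i \<and> x $ i < 1}"

text \<open>
  The cube has volume 1, so Lebesgue measure restricted to it is the uniform distribution.
  Its underlying space is the cube itself; values of \<open>f\<close> outside the cube never matter.
\<close>

definition cube_measure :: "(real ^ 'n) measure" where
  "cube_measure = restrict_space lborel open_cube"

lemma open_cube_eq_box: "open_cube = box (0 :: real ^ 'n) 1"
  by (auto simp: open_cube_def mem_box_cart)

lemma space_cube_measure: "space cube_measure = (open_cube :: (real ^ 'n) set)"
  by (simp add: cube_measure_def space_restrict_space)

lemma prob_space_cube_measure: "prob_space (cube_measure :: (real ^ 'n) measure)"
proof
  have "emeasure lborel (box (0 :: real ^ 'n) 1) = 1"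
    by (subst emeasure_lborel_box)
      (auto simp: inner_axis Basis_vec_def intro!: prod.neutral)
  then show "emeasure cube_measure (space (cube_measure :: (real ^ 'n) measure)) = 1"
    by (simp add: cube_measure_def space_restrict_space emeasure_restrict_space open_cube_eq_box)
qed

text \<open>
  The second-order partial derivatives (in every order of differentiation) exist on \<open>S\<close> and are
  continuous there; \<open>g i\<close> and \<open>h i j\<close> are the partial derivatives of first and second order.
  Continuity of \<open>f\<close> and of the \<open>g i\<close> on an open set \<open>S\<close> is a consequence.
\<close>

definition continuous_second_partials_on :: "(real ^ 'n) set \<Rightarrow> (real ^ 'n \<Rightarrow> real) \<Rightarrow> bool" where
  "continuous_second_partials_on S f \<longleftrightarrow>
    (\<exists>g h.
      (\<forall>x\<in>S. \<forall>i. ((\<lambda>t. f (x + t *\<^sub>R axis i 1)) has_real_derivative g i x) (at 0)) \<and>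
      (\<forall>x\<in>S. \<forall>i j. ((\<lambda>t. g i (x + t *\<^sub>R axis j 1)) has_real_derivative h i j x) (at 0)) \<and>
      (\<forall>i j. continuous_on S (h i j)))"

text \<open>The hybrid point with components of \<open>v\<close> on \<open>u\<close> and of \<open>z\<close> off \<open>u\<close>.\<close>

definition hybrid :: "'n set \<Rightarrow> real ^ 'n \<Rightarrow> real ^ 'n \<Rightarrow> real ^ 'n" where
  "hybrid u v z = (\<chi> j. if j \<in> u then v $ j else z $ j)"

text \<open>
  ANOVA components. The variables not in \<open>u\<close> are integrated out by integrating
  \<open>f (hybrid u x z)\<close> over all of \<open>z\<close>: the integrand does not depend on the components of \<open>z\<close>
  in \<open>u\<close>, and these carry total mass 1.
\<close>

function anova :: "(real ^ 'n \<Rightarrow> real) \<Rightarrow> 'n set \<Rightarrow> real ^ 'n \<Rightarrow> real" where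
  "anova f u x =
    (\<integral>z. f (hybrid u x z) \<partial>cube_measure) - (\<Sum>v | v \<subset> u. anova f v x)"
  by auto
termination
  by (relation "Wellfounded.measure (\<lambda>(f, u, x). card u)") (auto intro: psubset_card_mono)

declare anova.simps [simp del]

definition cube_variance :: "(real ^ 'n \<Rightarrow> real) \<Rightarrow> real" where
  "cube_variance g = prob_space.variance cube_measure g"

definition upper_sobol_index :: "(real ^ 'n \<Rightarrow> real) \<Rightarrow> 'n \<Rightarrow> real" where
  "upper_sobol_index f i =
    1 / cube_variance f * (\<Sum>u | i \<in> u. cube_variance (anova f u))"

text \<open>
  The vector of difference quotients. On the null set where \<open>v $ i = z $ i\<close> the \<open>i\<close>th entry
  takes the dummy value 0.
\<close>

definition diff_quotients :: "(real ^ 'n \<Rightarrow> real) \<Rightarrow> real ^ 'n \<Rightarrow> real ^ 'n \<Rightarrow> real ^ 'n" where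
  "diff_quotients f v z = (\<chi> i. (f (hybrid {i} v z) - f z) / (v $ i - z $ i))"

text \<open>
  The joint law of the independent uniform vectors \<open>(z, v)\<close>; \<open>z\<close> is the first projection.
\<close>

definition zv_measure :: "((real ^ 'n) \<times> (real ^ 'n)) measure" where
  "zv_measure = cube_measure \<Otimes>\<^sub>M cube_measure"

definition sigma_z :: "((real ^ 'n) \<times> (real ^ 'n)) measure" where
  "sigma_z = vimage_algebra (space zv_measure) fst cube_measure"

definition gas_integrand ::
  "(real ^ 'n \<Rightarrow> real) \<Rightarrow> 'n \<Rightarrow> 'n \<Rightarrow> (real ^ 'n) \<times> (real ^ 'n) \<Rightarrow> real" where
  "gas_integrand f i j = (\<lambda>(z, v). diff_quotients f v z $ i * diff_quotients f v z $ j)"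

definition C_gas :: "(real ^ 'n \<Rightarrow> real) \<Rightarrow> real ^ 'n ^ 'n" where
  "C_gas f = (\<chi> i j. \<integral>\<omega>. real_cond_exp zv_measure sigma_z (gas_integrand f i j) \<omega> \<partial>zv_measure)"

definition C_gas_well_defined :: "(real ^ 'n \<Rightarrow> real) \<Rightarrow> bool" where
  "C_gas_well_defined f \<longleftrightarrow> (\<forall>i j. integrable zv_measure (gas_integrand f i j))"

text \<open>
  An enumeration \<open>e\<close> of the index type numbers the coordinates by \<open>1, \<dots>, d\<close>, so that the
  \<open>j\<close>th column of \<open>U\<close> is \<open>column (e j) U\<close> and \<open>\<lambda>\<^sub>j\<close> is the \<open>j\<close>th diagonal entry of \<open>\<Lambda>\<close>.
\<close>

definition eigval :: "(nat \<Rightarrow> 'n) \<Rightarrow> real ^ 'n ^ 'n \<Rightarrow> nat \<Rightarrow> real" where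
  "eigval e \<Lambda> j = \<Lambda> $ e j $ e j"

text \<open>
  Nonnegativity of the eigenvalues is not part of the definition: for \<open>C_gas\<close> it
  follows from positive semidefiniteness.
\<close>

definition eigendecomposition ::
  "(nat \<Rightarrow> 'n) \<Rightarrow> real ^ 'n ^ 'n \<Rightarrow> real ^ 'n ^ 'n \<Rightarrow> real ^ 'n ^ 'n \<Rightarrow> bool" where
  "eigendecomposition e C U \<Lambda> \<longleftrightarrow>
    orthogonal_matrix U \<and>
    (\<forall>k l. k \<noteq> l \<longrightarrow> \<Lambda> $ k $ l = 0) \<and>
    C = U ** \<Lambda> ** transpose U \<and>
    antimono_on {1..CARD('n)} (eigval e \<Lambda>)"

definition activity_score ::
  "(nat \<Rightarrow> 'n) \<Rightarrow> real ^ 'n ^ 'n \<Rightarrow> real ^ 'n ^ 'n \<Rightarrow> 'n \<Rightarrow> nat \<Rightarrow> real" where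
  "activity_score e U \<Lambda> i m = (\<Sum>j = 1..m. eigval e \<Lambda> j * (U $ i $ e j)\<^sup>2)"

end

theory Submission
  imports Defs
begin

text \<open>
  The proof compares both sides with the \<open>i\<close>th diagonal entry of \<open>C_gas f\<close>.

  Write \<open>P\<^sub>u\<close> (\<open>marginal u\<close> below) for the operator that integrates out the coordinates outside \<open>u\<close>.
  Swapping coordinates between two independent uniform points preserves their joint law
  (\<open>distr_exchange\<close>), hence \<open>P\<^sub>u\<close> is self-adjoint and \<open>P\<^sub>u P\<^sub>v = P\<^sub>u\<^sub>\<inter>\<^sub>v\<close>. It follows that \<open>P\<^sub>u\<close> fixes
  the ANOVA component \<open>f\<^sub>v\<close> if \<open>v \<subseteq> u\<close> and annihilates it otherwise, so distinct components are
  orthogonal, and \<open>\<Sum>\<^sub>u\<^sub>\<ni>\<^sub>i \<sigma>\<^sub>u\<^sup>2\<close> is the squared norm of the function \<open>f - P f\<close>, where \<open>P\<close>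
  integrates out the \<open>i\<close>th coordinate alone (\<open>sum_variance_anova\<close>). This squared norm is half the
  mean square of the change of \<open>f\<close> when the \<open>i\<close>th coordinate is resampled
  (\<open>integral_square_diff_hybrid\<close>), which is the formula of Sobol'.

  The change in the \<open>i\<close>th coordinate is less than 1 in modulus, so the change of \<open>f\<close> is at most the
  difference quotient in modulus, and \<open>\<Sum>\<^sub>u\<^sub>\<ni>\<^sub>i \<sigma>\<^sub>u\<^sup>2\<close> is at most half the \<open>i\<close>th diagonal
  entry of \<open>C_gas f\<close> (\<open>upper_sobol_index_le_C_gas\<close>).

  That entry is \<open>\<Sum>\<^sub>j \<lambda>\<^sub>j u\<^sub>i\<^sub>j\<^sup>2\<close>. The first \<open>m\<close> terms form the activity score. In the others \<open>\<lambda>\<^sub>j\<close> is at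
  most \<open>\<lambda>\<^sub>m\<^sub>+\<^sub>1\<close>, which is nonnegative because \<open>C_gas f\<close> is positive semidefinite, and the weights
  \<open>u\<^sub>i\<^sub>j\<^sup>2\<close> sum to at most 1 because the rows of \<open>U\<close> are unit vectors
  (\<open>eigendecomposition_diagonal_le\<close>).

  The measurability of \<open>f\<close> on the cube comes from smoothness. Differentiability along each axis alone
  would not make \<open>f\<close> continuous; continuity of the second-order partial derivatives gives local
  Lipschitz bounds, first for the first-order ones and then for \<open>f\<close>.
\<close>

section \<open>Continuity from partial derivatives\<close>

text \<open>
  Replace the coordinates of \<open>x\<close> by those of \<open>y\<close> one at a time. No intermediate point leaves the
  box, and each replacement moves along one axis, where the mean value theorem applies.
\<close>
lemma abs_diff_hybrid_le:
  fixes f :: "real ^ 'n \<Rightarrow> real"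
  assumes deriv: "\<And>x i. x \<in> cbox a b \<Longrightarrow>
      ((\<lambda>t. f (x + t *\<^sub>R axis i 1)) has_real_derivative g i x) (at 0)"
    and bound: "\<And>x i. x \<in> cbox a b \<Longrightarrow> \<bar>g i x\<bar> \<le> B"
    and x: "x \<in> cbox a b" and y: "y \<in> cbox a b"
  shows "\<bar>f (hybrid A y x) - f x\<bar> \<le> B * (\<Sum>i\<in>A. \<bar>y $ i - x $ i\<bar>)"
proof (induction A rule: finite_induct[OF finite])
  case 1
  have "hybrid {} y x = x" by (simp add: hybrid_def vec_eq_iff)
  then show ?case by simp
next
  case (2 k A)
  define p where "p = hybrid A y x"
  define w where "w = (\<lambda>s. p + (s - p $ k) *\<^sub>R axis k 1)"
  have pk: "p $ k = x $ k" using 2 by (simp add: p_def hybrid_def)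
  have w_nth: "w s $ j = (if j = k then s else p $ j)" for s j
    by (simp add: w_def axis_def)
  have end1: "w (x $ k) = p" by (simp add: w_def pk)
  have end2: "w (y $ k) = hybrid (insert k A) y x"
    by (auto simp: vec_eq_iff w_nth hybrid_def p_def)
  have p_in: "p \<in> cbox a b" using x y by (auto simp: p_def hybrid_def mem_box_cart)
  have w_in: "w s \<in> cbox a b" if "s \<in> {min (x $ k) (y $ k)..max (x $ k) (y $ k)}" for s
  proof -
    have "a $ k \<le> s" "s \<le> b $ k"
      using x y that unfolding mem_box_cart min_def max_def
      by (auto split: if_splits intro: order_trans)
    then show ?thesis
      using p_in by (simp add: mem_box_cart w_nth)
  qed
  have d: "((\<lambda>s. f (w s)) has_real_derivative g k (w s)) (at s)"
    if "s \<in> {min (x $ k) (y $ k)..max (x $ k) (y $ k)}" for s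
  proof -
    \<comment> \<open>The partial derivatives are taken at parameter 0; shifting by \<open>s\<close> moves them onto the line \<open>w\<close>.\<close>
    have "((\<lambda>t. f (w s + t *\<^sub>R axis k 1)) has_real_derivative g k (w s)) (at (s + - s))"
      using deriv[OF w_in[OF that], of k] by simp
    then have "((\<lambda>t. f (w s + (t + - s) *\<^sub>R axis k 1)) has_real_derivative g k (w s)) (at s)"
      by (subst (asm) DERIV_shift)
    moreover have "w s + (t + - s) *\<^sub>R axis k 1 = w t" for t
      by (auto simp: vec_eq_iff w_nth axis_def)
    ultimately show ?thesis by simp
  qed
  have "norm (f (w (y $ k)) - f (w (x $ k))) \<le> B * norm (y $ k - x $ k)"
  proof (rule field_differentiable_bound[where f' = "\<lambda>s. g k (w s)"])
    show "convex {min (x $ k) (y $ k)..max (x $ k) (y $ k)}"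
      by simp
  next
    fix s assume s: "s \<in> {min (x $ k) (y $ k)..max (x $ k) (y $ k)}"
    show "((\<lambda>s. f (w s)) has_field_derivative g k (w s))
        (at s within {min (x $ k) (y $ k)..max (x $ k) (y $ k)})"
      using d[OF s] by (rule has_field_derivative_at_within)
    show "norm (g k (w s)) \<le> B"
      using bound[OF w_in[OF s]] by simp
  qed simp_all
  then have "\<bar>f (hybrid (insert k A) y x) - f p\<bar> \<le> B * \<bar>y $ k - x $ k\<bar>"
    by (simp add: end1 end2)
  moreover have "\<bar>f p - f x\<bar> \<le> B * (\<Sum>i\<in>A. \<bar>y $ i - x $ i\<bar>)"
    using 2 by (simp add: p_def)
  moreover have "B * (\<Sum>i\<in>insert k A. \<bar>y $ i - x $ i\<bar>)
      = B * \<bar>y $ k - x $ k\<bar> + B * (\<Sum>i\<in>A. \<bar>y $ i - x $ i\<bar>)"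
    using 2 by (simp add: distrib_left)
  ultimately show ?case by linarith
qed

text \<open>
  A compact box around a point bounds all the partial derivatives at once, and makes \<open>f\<close> Lipschitz
  there by the preceding estimate.
\<close>

lemma continuous_on_if_partials_continuous:
  fixes f :: "real ^ 'n \<Rightarrow> real"
  assumes S: "open S"
    and deriv: "\<And>x i. x \<in> S \<Longrightarrow>
      ((\<lambda>t. f (x + t *\<^sub>R axis i 1)) has_real_derivative g i x) (at 0)"
    and cont: "\<And>i. continuous_on S (g i)"
  shows "continuous_on S f"
proof (rule continuous_at_imp_continuous_on, rule ballI)
  fix x assume "x \<in> S"
  then obtain a b where ab: "x \<in> box a b" "cbox a b \<subseteq> S"
    using S by (meson open_contains_cbox)
  have "bounded (g i ` cbox a b)" for i
    by (intro compact_imp_bounded compact_continuous_image continuous_on_subset[OF cont ab(2)]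
        compact_cbox)
  then have "bounded (\<Union>i. g i ` cbox a b)"
    by (intro bounded_UN) auto
  then obtain B where "\<forall>r\<in>(\<Union>i. g i ` cbox a b). norm r \<le> B"
    unfolding bounded_iff by blast
  then have B: "\<bar>g i y\<bar> \<le> B" if "y \<in> cbox a b" for i y
    using that by (metis UNIV_I UN_I image_eqI real_norm_def)
  have x_in: "x \<in> cbox a b"
    using ab(1) box_subset_cbox by (rule subsetD[rotated])
  have deriv': "((\<lambda>t. f (y + t *\<^sub>R axis i 1)) has_real_derivative g i y) (at 0)"
    if "y \<in> cbox a b" for y i
    using deriv ab(2) that by (meson subsetD)
  have le: "\<bar>f y - f x\<bar> \<le> B * (\<Sum>i\<in>UNIV. \<bar>y $ i - x $ i\<bar>)" if "y \<in> box a b" for y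
  proof -
    have "hybrid UNIV y x = y" by (simp add: hybrid_def vec_eq_iff)
    moreover have "y \<in> cbox a b"
      using that box_subset_cbox by (rule subsetD[rotated])
    ultimately show ?thesis
      using abs_diff_hybrid_le[OF deriv' B x_in, of y UNIV] by simp
  qed
  have ev: "\<forall>\<^sub>F y in at x. norm (f y - f x) \<le> B * (\<Sum>i\<in>UNIV. \<bar>y $ i - x $ i\<bar>)"
    using eventually_at_in_open'[OF open_box ab(1)] by eventually_elim (use le in auto)
  have "((\<lambda>y. B * (\<Sum>i\<in>UNIV. \<bar>y $ i - x $ i\<bar>)) \<longlongrightarrow> B * (\<Sum>i\<in>UNIV. \<bar>x $ i - x $ i\<bar>)) (at x)"
    by (intro tendsto_intros)
  then have "((\<lambda>y. f y - f x) \<longlongrightarrow> 0) (at x)"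
    by (intro Lim_null_comparison[OF ev]) simp
  then show "isCont f x"
    unfolding isCont_def by (subst Lim_null)
qed

text \<open>
  The continuity of the second-order partial derivatives is lifted twice: to the first-order ones,
  and from these to \<open>f\<close>.
\<close>

lemma continuous_second_partials_imp_continuous:
  assumes "open S" "continuous_second_partials_on S f"
  shows "continuous_on S f"
proof -
  obtain g h where
    fg: "\<And>x i. x \<in> S \<Longrightarrow> ((\<lambda>t. f (x + t *\<^sub>R axis i 1)) has_real_derivative g i x) (at 0)"
    and gh: "\<And>x i j. x \<in> S \<Longrightarrow> ((\<lambda>t. g i (x + t *\<^sub>R axis j 1)) has_real_derivative h i j x) (at 0)"
    and h: "\<And>i j. continuous_on S (h i j)"
    using assms(2) unfolding continuous_second_partials_on_def by blast
  have "continuous_on S (g i)" for i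
    by (rule continuous_on_if_partials_continuous[OF assms(1) gh h])
  from this show ?thesis
    by (intro continuous_on_if_partials_continuous[OF assms(1) fg])
qed

section \<open>Exchanging coordinates of two uniform points\<close>

text \<open>
  The involution that swaps two points in the coordinates outside \<open>u\<close>. Its first component is
  \<open>hybrid u x z\<close>; the second one is kept so that the map is invertible.
\<close>

definition exchange :: "'n set \<Rightarrow> (real ^ 'n) \<times> (real ^ 'n) \<Rightarrow> (real ^ 'n) \<times> (real ^ 'n)" where
  "exchange u p = (hybrid u (fst p) (snd p), hybrid u (snd p) (fst p))"

lemma prod_Basis_cart:
  "(\<Prod>b\<in>(Basis :: (real ^ 'n) set). h b) = (\<Prod>i\<in>UNIV. h (axis i 1))"
proof -
  have "(Basis :: (real ^ 'n) set) = (\<lambda>i. axis i 1) ` UNIV"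
    by (auto simp: Basis_vec_def)
  moreover have "inj (\<lambda>i. axis i 1 :: real ^ 'n)"
    by (auto simp: inj_on_def axis_eq_axis)
  ultimately show ?thesis
    by (metis (no_types, lifting) prod.reindex_cong)
qed

lemma prod_Basis_cart_pair:
  "(\<Prod>b\<in>(Basis :: ((real ^ 'n) \<times> (real ^ 'n)) set). h b)
    = (\<Prod>i\<in>UNIV. h (axis i 1, 0) * h (0, axis i 1))"
proof -
  have "(\<Prod>b\<in>(Basis :: ((real ^ 'n) \<times> (real ^ 'n)) set). h b)
      = (\<Prod>b\<in>(\<lambda>u. (u, 0)) ` (Basis :: (real ^ 'n) set). h b)
        * (\<Prod>b\<in>(\<lambda>u. (0, u)) ` (Basis :: (real ^ 'n) set). h b)"
    unfolding Basis_prod_def by (rule prod.union_disjoint) auto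
  also have "\<dots> = (\<Prod>b\<in>(Basis :: (real ^ 'n) set). h (b, 0)) * (\<Prod>b\<in>(Basis :: (real ^ 'n) set). h (0, b))"
    by (simp add: prod.reindex inj_on_def)
  finally show ?thesis
    by (simp add: prod_Basis_cart prod.distrib)
qed

lemma mem_box_cart_pair:
  "p \<in> box l u \<longleftrightarrow> (\<forall>i. fst l $ i < fst p $ i \<and> fst p $ i < fst u $ i
      \<and> snd l $ i < snd p $ i \<and> snd p $ i < snd u $ i)"
  for p :: "(real ^ 'n) \<times> (real ^ 'n)"
  by (cases p; cases l; cases u) (auto simp: box_prod mem_box_cart)

lemma linear_exchange: "linear (exchange u)"
  by (rule linearI) (auto simp: exchange_def hybrid_def vec_eq_iff)

lemma exchange_exchange [simp]: "exchange u (exchange u p) = p"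
  by (auto simp: exchange_def hybrid_def vec_eq_iff prod_eq_iff)

lemma measurable_exchange_lborel: "exchange u \<in> lborel \<rightarrow>\<^sub>M lborel"
proof -
  have "continuous_on UNIV (exchange u)"
    by (simp add: linear_continuous_on linear_conv_bounded_linear[symmetric] linear_exchange)
  then show ?thesis
    by (simp add: borel_measurable_continuous_onI)
qed

text \<open>
  A permutation of the \<open>2d\<close> coordinates maps boxes to boxes with the same side lengths, and boxes
  determine Lebesgue measure.
\<close>

lemma distr_exchange_lborel:
  fixes u :: "'n::finite set"
  shows "distr lborel lborel (exchange u) = lborel"
proof (rule sym, rule lborel_eqI)
  fix l r :: "(real ^ 'n) \<times> (real ^ 'n)"
  assume le: "\<And>b. b \<in> Basis \<Longrightarrow> l \<bullet> b \<le> r \<bullet> b"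
  have le1: "fst l $ i \<le> fst r $ i" and le2: "snd l $ i \<le> snd r $ i" for i
    using le[of "(axis i 1, 0)"] le[of "(0, axis i 1)"]
    by (auto simp: inner_axis inner_prod_def Basis_prod_def)
  have le': "exchange u l \<bullet> b \<le> exchange u r \<bullet> b" if "b \<in> Basis" for b
    using that le1 le2
    by (auto simp: Basis_prod_def Basis_vec_def exchange_def hybrid_def inner_axis inner_prod_def)
  have pre: "exchange u -` box l r = box (exchange u l) (exchange u r)"
  proof (rule set_eqI)
    fix p
    show "p \<in> exchange u -` box l r \<longleftrightarrow> p \<in> box (exchange u l) (exchange u r)"
      unfolding vimage_eq mem_box_cart_pair
      by (intro iff_allI) (auto simp: exchange_def hybrid_def)
  qed
  have "emeasure (distr lborel lborel (exchange u)) (box l r)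
      = emeasure lborel (box (exchange u l) (exchange u r))"
    by (subst emeasure_distr[OF measurable_exchange_lborel]) (simp_all add: pre)
  also have "\<dots> = ennreal (\<Prod>b\<in>Basis. (exchange u r - exchange u l) \<bullet> b)"
    using le' by (rule emeasure_lborel_box)
  also have "(\<Prod>b\<in>Basis. (exchange u r - exchange u l) \<bullet> b) = (\<Prod>b\<in>Basis. (r - l) \<bullet> b)"
    unfolding prod_Basis_cart_pair
    by (intro prod.cong) (auto simp: exchange_def hybrid_def inner_axis inner_prod_def)
  finally show "emeasure (distr lborel lborel (exchange u)) (box l r)
      = ennreal (\<Prod>b\<in>Basis. (r - l) \<bullet> b)" .
qed simp

lemma open_cube_measurable [measurable]: "(open_cube :: (real ^ 'n) set) \<in> sets borel"
  by (simp add: open_cube_eq_box)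

text \<open>
  This lets the symmetry of Lebesgue measure on the pairs be transferred to the uniform
  distribution on pairs of points of the cube.
\<close>

lemma zv_measure_eq_restrict:
  "zv_measure = restrict_space lborel (open_cube \<times> open_cube :: ((real ^ 'n) \<times> (real ^ 'n)) set)"
  unfolding zv_measure_def
proof (rule pair_measure_eqI)
  interpret prob_space "cube_measure :: (real ^ 'n) measure"
    by (rule prob_space_cube_measure)
  show "sigma_finite_measure (cube_measure :: (real ^ 'n) measure)"
    "sigma_finite_measure (cube_measure :: (real ^ 'n) measure)"
    by unfold_locales
  let ?M = "cube_measure :: (real ^ 'n) measure" and ?Q = "open_cube :: (real ^ 'n) set"
  have sub: "A \<in> sets borel" if "A \<in> sets ?M" for A
    using that by (auto simp: cube_measure_def sets_restrict_space)
  have prod: "A \<times> B \<in> sets lborel" if "A \<in> sets ?M" "B \<in> sets ?M" for A B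
    unfolding sets_lborel borel_prod[symmetric] using sub that by (intro pair_measureI)
  show "sets (?M \<Otimes>\<^sub>M ?M) = sets (restrict_space lborel (?Q \<times> ?Q))"
  proof (intro equalityI subsetI)
    fix X assume X: "X \<in> sets (?M \<Otimes>\<^sub>M ?M)"
    have "sets (?M \<Otimes>\<^sub>M ?M) \<subseteq> sets (borel :: ((real ^ 'n) \<times> (real ^ 'n)) measure)"
      unfolding sets_pair_measure
      using prod[OF sets.top sets.top] by (intro sets.sigma_sets_subset') (auto dest: prod)
    moreover have "X \<subseteq> ?Q \<times> ?Q"
      using sets.sets_into_space[OF X] by (simp add: space_pair_measure space_cube_measure)
    ultimately show "X \<in> sets (restrict_space lborel (?Q \<times> ?Q))"
      using X by (auto simp: sets_restrict_space)
  next
    fix X assume "X \<in> sets (restrict_space lborel (?Q \<times> ?Q))"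
    then obtain Y where Y: "Y \<in> sets (lborel \<Otimes>\<^sub>M lborel)" "X = (?Q \<times> ?Q) \<inter> Y"
      by (auto simp: sets_restrict_space lborel_prod[symmetric] simp del: sets_lborel)
    have "id \<in> ?M \<rightarrow>\<^sub>M lborel"
      unfolding cube_measure_def by (intro measurable_restrict_space1) simp
    then have "(\<lambda>p. (id (fst p), id (snd p))) \<in> ?M \<Otimes>\<^sub>M ?M \<rightarrow>\<^sub>M lborel \<Otimes>\<^sub>M lborel"
      by measurable
    from measurable_sets[OF this Y(1)] show "X \<in> sets (?M \<Otimes>\<^sub>M ?M)"
      by (simp add: Y(2) space_pair_measure space_cube_measure Int_commute vimage_def)
  qed
  fix A B assume A: "A \<in> sets ?M" and B: "B \<in> sets ?M"
  have AB: "A \<subseteq> ?Q" "B \<subseteq> ?Q"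
    using sets.sets_into_space[OF A] sets.sets_into_space[OF B] by (auto simp: space_cube_measure)
  have Q2: "?Q \<times> ?Q \<in> sets borel"
    unfolding open_cube_eq_box by (intro borel_open open_Times open_box)
  have "emeasure (restrict_space lborel (?Q \<times> ?Q)) (A \<times> B) = emeasure (lborel \<Otimes>\<^sub>M lborel) (A \<times> B)"
    using AB by (subst emeasure_restrict_space) (auto simp: lborel_prod Q2)
  also have "\<dots> = emeasure lborel A * emeasure lborel B"
    using sub A B by (subst lborel.emeasure_pair_measure_Times) auto
  also have "\<dots> = emeasure ?M A * emeasure ?M B"
    using AB by (simp add: cube_measure_def emeasure_restrict_space)
  finally show "emeasure ?M A * emeasure ?M B = emeasure (restrict_space lborel (?Q \<times> ?Q)) (A \<times> B)" ..
qed

lemma hybrid_in_open_cube [simp]: "x \<in> open_cube \<Longrightarrow> z \<in> open_cube \<Longrightarrow> hybrid u x z \<in> open_cube"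
  by (auto simp: open_cube_def hybrid_def)

lemma space_zv_measure: "space zv_measure = (open_cube \<times> open_cube :: ((real ^ 'n) \<times> (real ^ 'n)) set)"
  by (simp add: zv_measure_def space_pair_measure space_cube_measure)

lemma measurable_exchange: "exchange u \<in> zv_measure \<rightarrow>\<^sub>M zv_measure"
  unfolding zv_measure_eq_restrict
  by (rule measurable_restrict_space3[OF measurable_exchange_lborel]) (auto simp: exchange_def)

text \<open>
  Swapping independent and identically distributed coordinates does not change the joint law. All
  properties of partial integration below come from this symmetry.
\<close>

lemma distr_exchange: "distr zv_measure zv_measure (exchange u) = zv_measure"
proof (rule measure_eqI)
  fix X :: "((real ^ 'a) \<times> (real ^ 'a)) set"
  let ?Q = "open_cube \<times> open_cube :: ((real ^ 'a) \<times> (real ^ 'a)) set"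
  assume "X \<in> sets (distr zv_measure zv_measure (exchange u))"
  then have X: "X \<in> sets zv_measure" by simp
  have Q2: "?Q \<in> sets borel"
    unfolding open_cube_eq_box by (intro borel_open open_Times open_box)
  have X': "X \<subseteq> ?Q" "X \<in> sets lborel"
    using X sets.sets_into_space[OF X] Q2
    by (auto simp: space_zv_measure zv_measure_eq_restrict sets_restrict_space)
  have pre: "exchange u -` X \<subseteq> ?Q"
  proof
    fix p assume "p \<in> exchange u -` X"
    then have "exchange u p \<in> ?Q" using X' by auto
    then have "exchange u (exchange u p) \<in> ?Q"
      by (subst exchange_def) auto
    then show "p \<in> ?Q" by simp
  qed
  have "emeasure (distr zv_measure zv_measure (exchange u)) X
      = emeasure lborel (exchange u -` X)"
    using pre X by (simp add: emeasure_distr measurable_exchange space_zv_measure Int_absorb2)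
      (simp add: zv_measure_eq_restrict emeasure_restrict_space Q2)
  also have "\<dots> = emeasure (distr lborel lborel (exchange u)) X"
    using X'(2) by (subst emeasure_distr[OF measurable_exchange_lborel]) simp_all
  also have "\<dots> = emeasure zv_measure X"
    using X' by (simp add: distr_exchange_lborel zv_measure_eq_restrict emeasure_restrict_space Q2)
  finally show "emeasure (distr zv_measure zv_measure (exchange u)) X = emeasure zv_measure X" .
qed simp

section \<open>Bounded measurable functions on the cube\<close>

interpretation cube: prob_space cube_measure
  by (rule prob_space_cube_measure)

interpretation zv: pair_prob_space cube_measure cube_measure ..

interpretation zv_prob: prob_space zv_measure
  unfolding zv_measure_def by unfold_locales

lemma integral_exchange:
  fixes F :: "(real ^ 'n) \<times> (real ^ 'n) \<Rightarrow> real"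
  assumes "F \<in> borel_measurable zv_measure"
  shows "(\<integral>p. F (exchange u p) \<partial>zv_measure) = (\<integral>p. F p \<partial>zv_measure)"
  using integral_distr[OF measurable_exchange assms, of u] by (simp add: distr_exchange)

text \<open>
  Bounded measurable functions on the cube are closed under products and partial integration, and
  are integrable, so no integrability has to be tracked for the ANOVA components.
\<close>

definition bounded_measurable :: "(real ^ 'n \<Rightarrow> real) \<Rightarrow> bool" where
  "bounded_measurable g \<longleftrightarrow>
    g \<in> borel_measurable cube_measure \<and> (\<exists>B. \<forall>x\<in>open_cube. \<bar>g x\<bar> \<le> B)"

lemma bounded_measurableD [measurable_dest]:
  "bounded_measurable g \<Longrightarrow> g \<in> borel_measurable cube_measure"
  by (simp add: bounded_measurable_def)

lemma bounded_measurable_diff: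
  assumes "bounded_measurable g" "bounded_measurable h"
  shows "bounded_measurable (\<lambda>x. g x - h x)"
proof -
  obtain B C where "\<forall>x\<in>open_cube. \<bar>g x\<bar> \<le> B" "\<forall>x\<in>open_cube. \<bar>h x\<bar> \<le> C"
    using assms by (auto simp: bounded_measurable_def)
  then have "\<forall>x\<in>open_cube. \<bar>g x - h x\<bar> \<le> B + C"
    by (meson abs_triangle_ineq4 add_mono order_trans)
  then show ?thesis
    using assms by (auto simp: bounded_measurable_def)
qed

lemma bounded_measurable_sum:
  assumes "\<And>k. k \<in> K \<Longrightarrow> bounded_measurable (g k)"
  shows "bounded_measurable (\<lambda>x. \<Sum>k\<in>K. g k x)"
proof -
  obtain B where "\<And>k x. k \<in> K \<Longrightarrow> x \<in> open_cube \<Longrightarrow> \<bar>g k x\<bar> \<le> B k"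
    using assms unfolding bounded_measurable_def by metis
  then have "\<forall>x\<in>open_cube. \<bar>\<Sum>k\<in>K. g k x\<bar> \<le> (\<Sum>k\<in>K. B k)"
    by (intro ballI order_trans[OF sum_abs] sum_mono)
  then show ?thesis
    using assms by (auto simp: bounded_measurable_def intro!: borel_measurable_sum)
qed

lemma bounded_measurable_mult:
  assumes "bounded_measurable g" "bounded_measurable h"
  shows "bounded_measurable (\<lambda>x. g x * h x)"
proof -
  obtain B C where "\<forall>x\<in>open_cube. \<bar>g x\<bar> \<le> B" "\<forall>x\<in>open_cube. \<bar>h x\<bar> \<le> C"
    using assms by (auto simp: bounded_measurable_def)
  then have "\<forall>x\<in>open_cube. \<bar>g x * h x\<bar> \<le> B * C"
    unfolding abs_mult by (intro ballI mult_mono) (blast intro: order_trans[OF abs_ge_zero] abs_ge_zero)+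
  then show ?thesis
    using assms by (auto simp: bounded_measurable_def)
qed

lemma integrable_bounded_measurable:
  assumes "bounded_measurable g"
  shows "integrable cube_measure g"
proof -
  obtain B where "\<forall>x\<in>open_cube. \<bar>g x\<bar> \<le> B"
    using assms by (auto simp: bounded_measurable_def)
  then show ?thesis
    using assms by (intro cube.integrable_const_bound[where B = B])
      (auto simp: space_cube_measure)
qed

lemma measurable_hybrid: "(\<lambda>p. hybrid u (fst p) (snd p)) \<in> zv_measure \<rightarrow>\<^sub>M cube_measure"
proof -
  have "fst \<in> (zv_measure :: ((real ^ 'a) \<times> (real ^ 'a)) measure) \<rightarrow>\<^sub>M cube_measure"
    by (simp add: zv_measure_def)
  from measurable_comp[OF measurable_exchange this] show ?thesis
    by (simp add: comp_def exchange_def)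
qed

lemma bounded_measurable_hybrid:
  assumes "bounded_measurable g" "x \<in> open_cube"
  shows "bounded_measurable (\<lambda>z. g (hybrid u x z))"
proof -
  have "(\<lambda>z. (x, z)) \<in> cube_measure \<rightarrow>\<^sub>M zv_measure"
    unfolding zv_measure_def using assms by (intro measurable_Pair1') (simp add: space_cube_measure)
  from measurable_compose[OF measurable_compose[OF this measurable_hybrid], of g borel] assms
  have "(\<lambda>z. g (hybrid u x z)) \<in> borel_measurable cube_measure"
    by (simp add: bounded_measurableD)
  moreover obtain B where "\<forall>x\<in>open_cube. \<bar>g x\<bar> \<le> B"
    using assms by (auto simp: bounded_measurable_def)
  then have "\<forall>z\<in>open_cube. \<bar>g (hybrid u x z)\<bar> \<le> B"
    using assms by simp
  ultimately show ?thesis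
    by (auto simp: bounded_measurable_def)
qed

text \<open>
  With \<open>u = UNIV\<close> or \<open>v = UNIV\<close> a factor depends on the first point alone, so all products that
  occur below are instances.
\<close>

lemma integrable_zv_measure_mult:
  assumes "bounded_measurable g" "bounded_measurable h"
  shows "integrable zv_measure
    (\<lambda>p. g (hybrid u (fst p) (snd p)) * h (hybrid v (fst p) (snd p)))"
proof -
  obtain B C where "\<forall>x\<in>open_cube. \<bar>g x\<bar> \<le> B" "\<forall>x\<in>open_cube. \<bar>h x\<bar> \<le> C"
    using assms by (auto simp: bounded_measurable_def)
  then have "\<forall>x\<in>open_cube. \<forall>y\<in>open_cube. \<bar>g x * h y\<bar> \<le> B * C"
    unfolding abs_mult by (intro ballI mult_mono) (blast intro: order_trans[OF abs_ge_zero] abs_ge_zero)+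
  moreover have "(\<lambda>p. g (hybrid u (fst p) (snd p)) * h (hybrid v (fst p) (snd p)))
      \<in> borel_measurable zv_measure"
    using measurable_compose[OF measurable_hybrid bounded_measurableD[OF assms(1)]]
      measurable_compose[OF measurable_hybrid bounded_measurableD[OF assms(2)]]
    by measurable
  ultimately show ?thesis
    by (intro zv_prob.integrable_const_bound[where B = "B * C"]) (auto simp: space_zv_measure)
qed

lemma hybrid_UNIV [simp]: "hybrid UNIV x z = x"
  and hybrid_empty [simp]: "hybrid {} x z = z"
  by (simp_all add: hybrid_def vec_eq_iff)

lemma integral_zv_measure:
  fixes F :: "(real ^ 'n) \<times> (real ^ 'n) \<Rightarrow> real"
  assumes "integrable zv_measure F"
  shows "(\<integral>p. F p \<partial>zv_measure) = (\<integral>x. \<integral>z. F (x, z) \<partial>cube_measure \<partial>cube_measure)"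
  using zv.integral_fst'[of F] assms by (simp add: zv_measure_def)

section \<open>Integrating out coordinates\<close>

text \<open>
  Conditional expectation given the coordinates in \<open>u\<close>, as a concrete integral. The next lemmas
  show that these operators form a commuting family of orthogonal projections of \<open>L\<^sup>2\<close>, with
  composition given by intersection of the index sets.
\<close>

definition marginal :: "'n set \<Rightarrow> (real ^ 'n \<Rightarrow> real) \<Rightarrow> real ^ 'n \<Rightarrow> real" where
  "marginal u g x = (\<integral>z. g (hybrid u x z) \<partial>cube_measure)"

lemma bounded_measurable_marginal:
  fixes g :: "real ^ 'n \<Rightarrow> real"
  assumes "bounded_measurable g"
  shows "bounded_measurable (marginal u g)"
proof -
  obtain B where B: "\<forall>x\<in>open_cube. \<bar>g x\<bar> \<le> B"
    using assms by (auto simp: bounded_measurable_def)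
  have "\<bar>marginal u g x\<bar> \<le> B" if x: "x \<in> open_cube" for x
  proof -
    have "\<bar>marginal u g x\<bar> \<le> (\<integral>z. \<bar>g (hybrid u x z)\<bar> \<partial>cube_measure)"
      unfolding marginal_def by (rule integral_abs_bound)
    also have "\<dots> \<le> (\<integral>z. B \<partial>(cube_measure :: (real ^ 'n) measure))"
      using B x integrable_bounded_measurable[OF bounded_measurable_hybrid[OF assms x]]
      by (intro integral_mono) (auto simp: space_cube_measure)
    finally show ?thesis by (simp add: cube.prob_space)
  qed
  moreover have "marginal u g \<in> borel_measurable cube_measure"
    unfolding marginal_def
    using measurable_compose[OF measurable_hybrid bounded_measurableD[OF assms]]
    by (intro cube.borel_measurable_lebesgue_integral) (simp add: zv_measure_def case_prod_unfold)
  ultimately show ?thesis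
    by (auto simp: bounded_measurable_def)
qed

lemma marginal_adjoint_pair:
  assumes "bounded_measurable g" "bounded_measurable h"
  shows "(\<integral>x. marginal u g x * h x \<partial>cube_measure)
    = (\<integral>p. g (hybrid u (fst p) (snd p)) * h (fst p) \<partial>zv_measure)"
  using integrable_zv_measure_mult[OF assms, of u UNIV]
  by (simp add: integral_zv_measure marginal_def)

text \<open>
  In \<open>\<integral>\<integral> g (hybrid u x z) * h x\<close> the exchange of \<open>x\<close> and \<open>z\<close> outside \<open>u\<close> moves the hybrid point
  from \<open>g\<close> to \<open>h\<close>.
\<close>

lemma marginal_adjoint:
  assumes "bounded_measurable g" "bounded_measurable h"
  shows "(\<integral>x. marginal u g x * h x \<partial>cube_measure) = (\<integral>x. g x * marginal u h x \<partial>cube_measure)"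
proof -
  have "(\<integral>x. marginal u g x * h x \<partial>cube_measure)
      = (\<integral>p. g (fst (exchange u p)) * h (fst (exchange u (exchange u p))) \<partial>zv_measure)"
    unfolding marginal_adjoint_pair[OF assms] exchange_exchange by (simp add: exchange_def)
  also have "\<dots> = (\<integral>p. g (fst p) * h (fst (exchange u p)) \<partial>zv_measure)"
    using borel_measurable_integrable[OF integrable_zv_measure_mult[OF assms, of UNIV u]]
    by (intro integral_exchange[where F = "\<lambda>p. g (fst p) * h (fst (exchange u p))"]) (simp add: exchange_def)
  also have "\<dots> = (\<integral>x. marginal u h x * g x \<partial>cube_measure)"
    unfolding marginal_adjoint_pair[OF assms(2,1)] by (simp add: exchange_def mult.commute)
  finally show ?thesis
    by (simp add: mult.commute)
qed

text \<open>
  The hybrid point is the first component of an exchanged pair, and is therefore uniform again.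
\<close>

lemma integral_hybrid:
  fixes k :: "real ^ 'n \<Rightarrow> real"
  assumes "bounded_measurable k"
  shows "(\<integral>p. k (hybrid u (fst p) (snd p)) \<partial>zv_measure) = (\<integral>x. k x \<partial>cube_measure)"
proof -
  have one: "bounded_measurable (\<lambda>_ :: real ^ 'n. 1)"
    by (auto simp: bounded_measurable_def)
  note int = integrable_zv_measure_mult[OF assms one, of UNIV, simplified]
  have "(\<integral>p. k (hybrid u (fst p) (snd p)) \<partial>zv_measure) = (\<integral>p. k (fst (exchange u p)) \<partial>zv_measure)"
    by (simp add: exchange_def)
  also have "\<dots> = (\<integral>p. k (fst p) \<partial>zv_measure)"
    using integral_exchange[OF borel_measurable_integrable[OF int]] .
  also have "\<dots> = (\<integral>x. k x \<partial>cube_measure)"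
    using integral_zv_measure[OF int] by (simp add: cube.prob_space)
  finally show ?thesis .
qed

text \<open>
  Hybridizing first with \<open>z\<close> off \<open>u\<close> and then with \<open>y\<close> off \<open>v\<close> keeps \<open>x\<close> exactly on \<open>u \<inter> v\<close>; the
  remaining coordinates are those of \<open>hybrid v z y\<close>, which is uniform.
\<close>

lemma marginal_marginal:
  fixes g :: "real ^ 'n \<Rightarrow> real"
  assumes g: "bounded_measurable g" and x: "x \<in> open_cube"
  shows "marginal u (marginal v g) x = marginal (u \<inter> v) g x"
proof -
  let ?k = "\<lambda>z. g (hybrid (u \<inter> v) x z)"
  have k: "bounded_measurable ?k"
    using bounded_measurable_hybrid[OF g x] .
  have one: "bounded_measurable (\<lambda>_ :: real ^ 'n. 1)"
    by (auto simp: bounded_measurable_def)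
  have "hybrid v (hybrid u x z) y = hybrid (u \<inter> v) x (hybrid v z y)" for z y
    by (simp add: hybrid_def vec_eq_iff)
  then have "marginal u (marginal v g) x
      = (\<integral>z. \<integral>y. ?k (hybrid v z y) \<partial>cube_measure \<partial>cube_measure)"
    by (simp add: marginal_def)
  also have "\<dots> = (\<integral>p. ?k (hybrid v (fst p) (snd p)) \<partial>zv_measure)"
    using integrable_zv_measure_mult[OF k one, of v] by (simp add: integral_zv_measure)
  also have "\<dots> = marginal (u \<inter> v) g x"
    unfolding integral_hybrid[OF k] by (simp add: marginal_def)
  finally show ?thesis .
qed

lemma marginal_diff:
  assumes "bounded_measurable g" "bounded_measurable h" "x \<in> open_cube"
  shows "marginal u (\<lambda>y. g y - h y) x = marginal u g x - marginal u h x"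
  unfolding marginal_def
  by (intro Bochner_Integration.integral_diff integrable_bounded_measurable
      bounded_measurable_hybrid assms)

lemma marginal_sum:
  assumes "\<And>k. k \<in> K \<Longrightarrow> bounded_measurable (g k)" "x \<in> open_cube"
  shows "marginal u (\<lambda>y. \<Sum>k\<in>K. g k y) x = (\<Sum>k\<in>K. marginal u (g k) x)"
  unfolding marginal_def
  by (intro Bochner_Integration.integral_sum integrable_bounded_measurable
      bounded_measurable_hybrid assms)

lemma marginal_UNIV [simp]: "marginal UNIV g x = g x"
  by (simp add: marginal_def cube.prob_space)

section \<open>ANOVA components and the formula of Sobol'\<close>

lemma anova_eq_marginal: "anova f u x = marginal u f x - (\<Sum>v | v \<subset> u. anova f v x)"
  by (subst anova.simps) (simp add: marginal_def)

lemma sum_anova: "(\<Sum>v | v \<subseteq> u. anova f v x) = marginal u f x"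
proof -
  have "{v. v \<subseteq> u} = insert u {v. v \<subset> u}" by auto
  then show ?thesis by (simp add: anova_eq_marginal[of f u])
qed

lemma bounded_measurable_anova:
  assumes "bounded_measurable f"
  shows "bounded_measurable (anova f u)"
proof (induction u rule: finite_psubset_induct[OF finite])
  case (1 u)
  have "anova f u = (\<lambda>x. marginal u f x - (\<Sum>v | v \<subset> u. anova f v x))"
    by (rule ext) (rule anova_eq_marginal)
  then show ?case
    using 1 by (auto intro!: bounded_measurable_diff bounded_measurable_sum
        bounded_measurable_marginal assms)
qed

text \<open>
  The component \<open>anova f v\<close> depends on the coordinates in \<open>v\<close> only, and integrating out any one of
  them annihilates it. By induction the two cases follow from the fact that the components indexed
  by the subsets of \<open>u \<inter> v\<close> add up to \<open>marginal (u \<inter> v) f\<close>.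
\<close>

lemma marginal_anova:
  assumes f: "bounded_measurable f" and x: "x \<in> open_cube"
  shows "marginal u (anova f v) x = (if v \<subseteq> u then anova f v x else 0)"
proof (induction v rule: finite_psubset_induct[OF finite])
  case (1 v)
  have anova_v: "anova f v = (\<lambda>x. marginal v f x - (\<Sum>w | w \<subset> v. anova f w x))"
    by (rule ext) (rule anova_eq_marginal)
  have "marginal u (anova f v) x
      = marginal u (marginal v f) x - (\<Sum>w | w \<subset> v. marginal u (anova f w) x)"
    unfolding anova_v using f x
    by (subst marginal_diff)
      (auto simp: marginal_sum bounded_measurable_marginal bounded_measurable_sum
        bounded_measurable_anova)
  also have "(\<Sum>w | w \<subset> v. marginal u (anova f w) x)
      = (\<Sum>w | w \<subset> v \<and> w \<subseteq> u. anova f w x)"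
    using 1 by (simp add: sum.If_cases Int_def cong: conj_cong)
  finally have eq: "marginal u (anova f v) x
      = marginal (u \<inter> v) f x - (\<Sum>w | w \<subset> v \<and> w \<subseteq> u. anova f w x)"
    using f x by (simp add: marginal_marginal)
  show ?case
  proof (cases "v \<subseteq> u")
    case True
    then have "{w. w \<subset> v \<and> w \<subseteq> u} = {w. w \<subset> v}" "u \<inter> v = v" by auto
    then show ?thesis using True eq anova_eq_marginal[of f v x] by simp
  next
    case False
    then have "{w. w \<subset> v \<and> w \<subseteq> u} = {w. w \<subseteq> u \<inter> v}" by auto
    then show ?thesis using False eq sum_anova[where f = f and u = "u \<inter> v" and x = x] by simp
  qed
qed

lemma integral_cube_cong:
  "(\<And>x. x \<in> open_cube \<Longrightarrow> g x = h x) \<Longrightarrow> (\<integral>x. g x \<partial>cube_measure) = (\<integral>x. h x \<partial>cube_measure)"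
  by (rule Bochner_Integration.integral_cong) (simp_all add: space_cube_measure)

lemma integral_cube_eq_0:
  "(\<And>x. x \<in> open_cube \<Longrightarrow> g x = 0) \<Longrightarrow> (\<integral>x. g x \<partial>cube_measure) = 0"
  using integral_cube_cong[of g "\<lambda>_. 0"] by simp

text \<open>
  One of the two index sets is not contained in the other, say \<open>v\<close> not in \<open>u\<close>. The projection onto
  the coordinates in \<open>u\<close> fixes \<open>anova f u\<close> and kills \<open>anova f v\<close>.
\<close>

lemma anova_orthogonal:
  assumes f: "bounded_measurable f" and "u \<noteq> v"
  shows "(\<integral>x. anova f u x * anova f v x \<partial>cube_measure) = 0"
proof -
  have aux: "(\<integral>x. anova f u x * anova f v x \<partial>cube_measure) = 0" if "\<not> v \<subseteq> u" for u v
  proof -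
    have "(\<integral>x. anova f u x * anova f v x \<partial>cube_measure)
        = (\<integral>x. marginal u (anova f u) x * anova f v x \<partial>cube_measure)"
      by (rule integral_cube_cong) (simp add: marginal_anova[OF f])
    also have "\<dots> = (\<integral>x. anova f u x * marginal u (anova f v) x \<partial>cube_measure)"
      by (intro marginal_adjoint bounded_measurable_anova f)
    also have "\<dots> = 0"
      by (rule integral_cube_eq_0) (use that in \<open>simp add: marginal_anova[OF f]\<close>)
    finally show ?thesis .
  qed
  consider "\<not> v \<subseteq> u" | "\<not> u \<subseteq> v" using assms(2) by blast
  then show ?thesis
    using aux[of v u] aux[of u v] by cases (simp_all add: mult.commute)
qed

lemma integral_anova:
  assumes f: "bounded_measurable f" and "u \<noteq> {}"
  shows "(\<integral>x. anova f u x \<partial>cube_measure) = 0"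
proof -
  obtain x :: "real ^ 'a" where "x \<in> open_cube"
    using cube.not_empty by (auto simp: space_cube_measure)
  then show ?thesis
    using marginal_anova[OF f, of x "{}" u] assms(2) by (simp add: marginal_def)
qed

text \<open>
  The components with \<open>i \<in> u\<close> are those left over when \<open>marginal (- {i}) f\<close>, the sum of all the
  others, is subtracted from \<open>f\<close>; Pythagoras gives the claim.
\<close>

lemma sum_variance_anova:
  fixes f :: "real ^ 'n \<Rightarrow> real"
  assumes f: "bounded_measurable f"
  shows "(\<Sum>u | i \<in> u. cube_variance (anova f u))
    = (\<integral>x. (f x - marginal (- {i}) f x)\<^sup>2 \<partial>cube_measure)"
proof -
  let ?K = "{u :: 'n set. i \<in> u}"
  have int: "integrable cube_measure (\<lambda>x. anova f u x * anova f v x)" for u v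
    by (intro integrable_bounded_measurable bounded_measurable_mult bounded_measurable_anova f)
  have split: "f x - marginal (- {i}) f x = (\<Sum>u\<in>?K. anova f u x)" for x
  proof -
    have "(\<Sum>u | u \<subseteq> UNIV. anova f u x)
        = (\<Sum>u\<in>?K. anova f u x) + (\<Sum>u | u \<subseteq> - {i}. anova f u x)"
      by (subst sum.union_disjoint[symmetric]) (auto intro!: sum.cong)
    then show ?thesis by (simp only: sum_anova marginal_UNIV)
  qed
  have "(\<integral>x. (f x - marginal (- {i}) f x)\<^sup>2 \<partial>cube_measure)
      = (\<integral>x. (\<Sum>u\<in>?K. \<Sum>v\<in>?K. anova f u x * anova f v x) \<partial>cube_measure)"
    by (simp only: split power2_eq_square sum_product)
  also have "\<dots> = (\<Sum>u\<in>?K. \<Sum>v\<in>?K. \<integral>x. anova f u x * anova f v x \<partial>cube_measure)"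
    by (simp add: int)
  also have "\<dots> = (\<Sum>u\<in>?K. \<Sum>v\<in>?K. if v = u then \<integral>x. anova f u x * anova f u x \<partial>cube_measure else 0)"
    using anova_orthogonal[OF f] by (intro sum.cong) auto
  also have "\<dots> = (\<Sum>u\<in>?K. \<integral>x. anova f u x * anova f u x \<partial>cube_measure)"
    by (intro sum.cong) (auto simp: sum.delta)
  also have "\<dots> = (\<Sum>u\<in>?K. cube_variance (anova f u))"
  proof (intro sum.cong refl)
    fix u assume "u \<in> ?K"
    then have "(\<integral>x. anova f u x \<partial>cube_measure) = 0"
      by (intro integral_anova f) auto
    then show "(\<integral>x. anova f u x * anova f u x \<partial>cube_measure) = cube_variance (anova f u)"
      by (simp add: cube_variance_def power2_eq_square)
  qed
  finally show ?thesis ..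
qed

text \<open>
  Given the coordinates in \<open>u\<close>, the values of \<open>f\<close> at \<open>z\<close> and at the hybrid point are independent
  and identically distributed, and the mean square difference of two such variables is twice their
  variance. In the proof both values are centred by the common conditional mean, which leaves the
  difference unchanged and makes the mixed term vanish.
\<close>

lemma integral_square_diff_hybrid:
  fixes f :: "real ^ 'n \<Rightarrow> real"
  assumes f: "bounded_measurable f"
  shows "(\<integral>p. (f (fst p) - f (hybrid u (fst p) (snd p)))\<^sup>2 \<partial>zv_measure)
    = 2 * (\<integral>x. (f x - marginal u f x)\<^sup>2 \<partial>cube_measure)"
proof -
  define g where "g = (\<lambda>x. f x - marginal u f x)"
  have g: "bounded_measurable g"
    unfolding g_def by (intro bounded_measurable_diff bounded_measurable_marginal f)
  have gg: "bounded_measurable (\<lambda>x. g x * g x)"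
    by (intro bounded_measurable_mult g)
  have g0: "marginal u g x = 0" if "x \<in> open_cube" for x
    unfolding g_def using f that
    by (simp add: marginal_diff bounded_measurable_marginal marginal_marginal)
  have same: "marginal u f (hybrid u x z) = marginal u f x" for x z
    by (simp add: marginal_def hybrid_def cong: if_cong)
  let ?g1 = "\<lambda>p. g (fst p)" and ?g2 = "\<lambda>p. g (hybrid u (fst p) (snd p))"
  have int: "integrable zv_measure (\<lambda>p. ?g1 p * ?g1 p)" "integrable zv_measure (\<lambda>p. ?g2 p * ?g2 p)"
    "integrable zv_measure (\<lambda>p. ?g2 p * ?g1 p)"
    using integrable_zv_measure_mult[OF g g, of UNIV UNIV] integrable_zv_measure_mult[OF g g, of u u]
      integrable_zv_measure_mult[OF g g, of u UNIV] by simp_all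
  have "(\<integral>p. ?g2 p * ?g1 p \<partial>zv_measure) = (\<integral>x. marginal u g x * g x \<partial>cube_measure)"
    by (rule marginal_adjoint_pair[OF g g, symmetric])
  also have "\<dots> = 0"
    by (rule integral_cube_eq_0) (simp add: g0)
  finally have cross: "(\<integral>p. ?g2 p * ?g1 p \<partial>zv_measure) = 0" .
  have "(\<integral>p. (f (fst p) - f (hybrid u (fst p) (snd p)))\<^sup>2 \<partial>zv_measure)
      = (\<integral>p. ?g1 p * ?g1 p + ?g2 p * ?g2 p - 2 * (?g2 p * ?g1 p) \<partial>zv_measure)"
    by (simp add: g_def same power2_eq_square algebra_simps)
  also have "\<dots> = 2 * (\<integral>x. g x * g x \<partial>cube_measure)"
    using int integral_hybrid[OF gg, of UNIV] integral_hybrid[OF gg, of u] cross by simp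
  finally show ?thesis
    by (simp add: g_def power2_eq_square)
qed

section \<open>The matrix of difference quotients\<close>

text \<open>
  Taking the expectation of a conditional expectation removes the conditioning.
\<close>

lemma C_gas_nth:
  fixes f :: "real ^ 'n \<Rightarrow> real"
  assumes "C_gas_well_defined f"
  shows "C_gas f $ i $ j = (\<integral>p. gas_integrand f i j p \<partial>zv_measure)"
proof -
  have fst: "fst \<in> space zv_measure \<rightarrow> space (cube_measure :: (real ^ 'n) measure)"
    by (auto simp: space_zv_measure space_cube_measure)
  have "fst \<in> zv_measure \<rightarrow>\<^sub>M (cube_measure :: (real ^ 'n) measure)"
    by (simp add: zv_measure_def)
  then have "subalgebra zv_measure (sigma_z :: ((real ^ 'n) \<times> (real ^ 'n)) measure)"
    unfolding subalgebra_def sigma_z_def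
    by (auto simp: sets_vimage_algebra2[OF fst] measurable_sets)
  then interpret finite_measure_subalgebra zv_measure "sigma_z :: ((real ^ 'n) \<times> (real ^ 'n)) measure"
    by unfold_locales
  show ?thesis
    using real_cond_exp_int(2)[of "gas_integrand f i j"] assms
    by (simp add: C_gas_def C_gas_well_defined_def)
qed

text \<open>
  The quadratic form of a second moment matrix is the mean square of a linear combination of the
  random entries.
\<close>

lemma C_gas_quadratic_form_nonneg:
  fixes f :: "real ^ 'n \<Rightarrow> real"
  assumes "C_gas_well_defined f"
  shows "0 \<le> w \<bullet> (C_gas f *v w)"
proof -
  have int: "integrable zv_measure (gas_integrand f i j)" for i j
    using assms by (simp add: C_gas_well_defined_def)
  have "w \<bullet> (C_gas f *v w)
      = (\<Sum>i\<in>UNIV. \<Sum>j\<in>UNIV. w $ i * w $ j * C_gas f $ i $ j)"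
    by (simp add: inner_vec_def matrix_vector_mult_def sum_distrib_left mult_ac)
  also have "\<dots> = (\<integral>p. (\<Sum>i\<in>UNIV. \<Sum>j\<in>UNIV. w $ i * w $ j * gas_integrand f i j p) \<partial>zv_measure)"
    using int by (simp add: C_gas_nth[OF assms])
  also have "\<dots> = (\<integral>p. (\<Sum>i\<in>UNIV. w $ i * diff_quotients f (snd p) (fst p) $ i)\<^sup>2 \<partial>zv_measure)"
    by (simp add: gas_integrand_def case_prod_unfold power2_eq_square sum_product mult_ac)
  also have "\<dots> \<ge> 0"
    by (rule Bochner_Integration.integral_nonneg) simp
  finally show ?thesis .
qed

text \<open>
  Coordinates in \<open>(0, 1)\<close> differ by less than 1, so a difference of values of \<open>f\<close> is dominated by
  its difference quotient.
\<close>

lemma upper_sobol_index_le_C_gas: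
  fixes f :: "real ^ 'n \<Rightarrow> real"
  assumes f: "bounded_measurable f" and C: "C_gas_well_defined f" and "cube_variance f > 0"
  shows "upper_sobol_index f i \<le> 1 / 2 * (C_gas f $ i $ i / cube_variance f)"
proof -
  have hyb: "hybrid {i} v z = hybrid (- {i}) z v" for v z :: "real ^ 'n"
    by (simp add: hybrid_def vec_eq_iff)
  have le: "(f z - f (hybrid (- {i}) z v))\<^sup>2 \<le> gas_integrand f i i (z, v)"
    if "z \<in> open_cube" "v \<in> open_cube" for z v
  proof (cases "v $ i = z $ i")
    case True
    \<comment> \<open>The dummy value 0 of the quotient is harmless: the difference vanishes as well.\<close>
    then have "hybrid (- {i}) z v = z"
      by (auto simp: hybrid_def vec_eq_iff)
    then show ?thesis
      by (simp add: gas_integrand_def)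
  next
    case False
    have "\<bar>v $ i - z $ i\<bar> \<le> 1"
      using that by (auto simp: open_cube_def abs_le_iff) (smt (verit))+
    then have "(v $ i - z $ i)\<^sup>2 \<le> 1"
      by (simp add: abs_square_le_1)
    then have "(f z - f (hybrid (- {i}) z v))\<^sup>2 * (v $ i - z $ i)\<^sup>2 \<le> (f z - f (hybrid (- {i}) z v))\<^sup>2"
      by (simp add: mult_left_le)
    then show ?thesis
      using False
      by (simp add: gas_integrand_def diff_quotients_def hyb power2_eq_square[symmetric] power_divide
          pos_le_divide_eq power2_commute)
  qed
  have "2 * (\<Sum>u | i \<in> u. cube_variance (anova f u))
      = (\<integral>p. (f (fst p) - f (hybrid (- {i}) (fst p) (snd p)))\<^sup>2 \<partial>zv_measure)"
    by (simp add: sum_variance_anova[OF f] integral_square_diff_hybrid[OF f])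
  also have "\<dots> \<le> (\<integral>p. gas_integrand f i i p \<partial>zv_measure)"
    using C le
    by (intro integral_mono') (auto simp: C_gas_well_defined_def space_zv_measure gas_integrand_def)
  also have "\<dots> = C_gas f $ i $ i"
    by (simp add: C_gas_nth[OF C])
  finally show ?thesis
    using assms(3) by (simp add: upper_sobol_index_def divide_simps)
qed

section \<open>Eigenvalue decompositions\<close>

lemma eigendecomposition_nth:
  fixes C :: "real ^ 'n ^ 'n"
  assumes "eigendecomposition e C U \<Lambda>"
  shows "C $ i $ j = (\<Sum>k\<in>UNIV. \<Lambda> $ k $ k * U $ i $ k * U $ j $ k)"
proof -
  have diag: "\<Lambda> $ k $ l = (if l = k then \<Lambda> $ k $ k else 0)" for k l
    using assms by (auto simp: eigendecomposition_def)
  have "(U ** \<Lambda>) $ i $ k = U $ i $ k * \<Lambda> $ k $ k" for k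
    unfolding matrix_matrix_mult_def by (subst diag) (simp add: if_distrib cong: if_cong)
  moreover have "C = U ** \<Lambda> ** transpose U"
    using assms by (simp add: eigendecomposition_def)
  ultimately show ?thesis
    by (simp add: matrix_matrix_mult_def[of "U ** \<Lambda>"] transpose_def mult_ac)
qed

text \<open>
  The columns of \<open>U\<close> are orthonormal eigenvectors. In this form the sign of an eigenvalue can be
  read off from a semidefinite \<open>C\<close>.
\<close>

lemma eigval_eq_quadratic_form:
  fixes C :: "real ^ 'n ^ 'n"
  assumes "eigendecomposition e C U \<Lambda>"
  shows "eigval e \<Lambda> j = column (e j) U \<bullet> (C *v column (e j) U)"
proof -
  have U: "transpose U ** U = mat 1" "C = U ** \<Lambda> ** transpose U"
    using assms by (auto simp: eigendecomposition_def orthogonal_matrix_def)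
  then have L: "\<Lambda> = transpose U ** (C ** U)"
    by (metis matrix_mul_assoc matrix_mul_lid matrix_mul_rid)
  show ?thesis
    unfolding eigval_def
    by (subst L) (simp add: matrix_matrix_mult_def matrix_vector_mult_def transpose_def column_def inner_vec_def)
qed

text \<open>
  A diagonal entry of \<open>C\<close> is the average of the eigenvalues with the squared entries of a row of
  \<open>U\<close> as weights. The terms beyond \<open>m\<close> have eigenvalues at most \<open>\<lambda>\<^sub>m\<^sub>+\<^sub>1\<close>, and their weights
  add up to at most 1; since \<open>\<lambda>\<^sub>m\<^sub>+\<^sub>1\<close> is nonnegative, their sum is at most \<open>\<lambda>\<^sub>m\<^sub>+\<^sub>1\<close>.
\<close>

lemma eigendecomposition_diagonal_le:
  fixes C :: "real ^ 'n ^ 'n"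
  assumes eig: "eigendecomposition e C U \<Lambda>" and e: "bij_betw e {1..CARD('n)} UNIV"
    and m: "m < CARD('n)" and nonneg: "0 \<le> eigval e \<Lambda> (m + 1)"
  shows "C $ i $ i \<le> activity_score e U \<Lambda> i m + eigval e \<Lambda> (m + 1)"
proof -
  let ?d = "CARD('n)" and ?w = "\<lambda>j. (U $ i $ e j)\<^sup>2"
  have anti: "eigval e \<Lambda> j \<le> eigval e \<Lambda> (m + 1)" if "j \<in> {m + 1..?d}" for j
    using eig that m unfolding eigendecomposition_def monotone_on_def by auto
  have split: "(\<Sum>j = 1..?d. h j) = (\<Sum>j = 1..m. h j) + (\<Sum>j = m + 1..?d. h j)" for h :: "nat \<Rightarrow> real"
    using m sum.ub_add_nat[of 1 m h "?d - m"] by simp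
  have "(U ** transpose U) $ i $ i = mat 1 $ i $ i"
    using eig by (simp add: eigendecomposition_def orthogonal_matrix_def)
  then have "(\<Sum>k\<in>UNIV. (U $ i $ k)\<^sup>2) = 1"
    by (simp add: matrix_matrix_mult_def transpose_def mat_def power2_eq_square)
  then have row: "(\<Sum>j = 1..?d. ?w j) = 1"
    using sum.reindex_bij_betw[OF e, of "\<lambda>k. (U $ i $ k)\<^sup>2"] by simp
  have "C $ i $ i = (\<Sum>k\<in>UNIV. \<Lambda> $ k $ k * (U $ i $ k)\<^sup>2)"
    by (simp add: eigendecomposition_nth[OF eig] power2_eq_square mult.assoc)
  also have "\<dots> = (\<Sum>j = 1..?d. eigval e \<Lambda> j * ?w j)"
    unfolding eigval_def
    by (rule sum.reindex_bij_betw[OF e, of "\<lambda>k. \<Lambda> $ k $ k * (U $ i $ k)\<^sup>2", symmetric])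
  also have "\<dots> = activity_score e U \<Lambda> i m + (\<Sum>j = m + 1..?d. eigval e \<Lambda> j * ?w j)"
    by (simp only: split activity_score_def)
  also have "(\<Sum>j = m + 1..?d. eigval e \<Lambda> j * ?w j) \<le> (\<Sum>j = m + 1..?d. eigval e \<Lambda> (m + 1) * ?w j)"
    by (intro sum_mono mult_right_mono anti) auto
  also have "\<dots> = eigval e \<Lambda> (m + 1) * (\<Sum>j = m + 1..?d. ?w j)"
    by (simp only: sum_distrib_left)
  also have "(\<Sum>j = m + 1..?d. ?w j) \<le> 1"
    using row split[of ?w] sum_nonneg[of "{1..m}" ?w] by simp
  finally show ?thesis
    using nonneg by (simp add: mult_left_mono)
qed

section \<open>The bound by activity scores\<close>

theorem corollary3p3:
  fixes f :: "real ^ 'n \<Rightarrow> real"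
    and e :: "nat \<Rightarrow> 'n"
    and U \<Lambda> :: "real ^ 'n ^ 'n"
    and m :: nat
    and i :: 'n
  assumes "CARD('n) \<ge> 2"
    and "bij_betw e {1..CARD('n)} UNIV"
    and "integrable cube_measure (\<lambda>x. (f x)\<^sup>2)"
    and "bounded (f ` open_cube)"
    and "continuous_second_partials_on open_cube f"
    and "cube_variance f > 0"
    and "C_gas_well_defined f"
    and "eigendecomposition e (C_gas f) U \<Lambda>"
    and "1 \<le> m" and "m \<le> CARD('n) - 1"
  shows "upper_sobol_index f i \<le>
    1 / 2 * ((activity_score e U \<Lambda> i m + eigval e \<Lambda> (m + 1)) / cube_variance f)"
proof -
  have "open (open_cube :: (real ^ 'n) set)"
    unfolding open_cube_eq_box by (rule open_box)
  then have "continuous_on open_cube f"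
    using assms(5) by (rule continuous_second_partials_imp_continuous)
  then have "f \<in> borel_measurable cube_measure"
    unfolding cube_measure_def
    by (subst measurable_cong_sets[OF sets_restrict_space_cong[of lborel borel] refl])
      (auto intro: borel_measurable_continuous_on_restrict)
  moreover obtain B where "\<forall>x\<in>open_cube. \<bar>f x\<bar> \<le> B"
    using assms(4) by (auto simp: bounded_iff)
  ultimately have f: "bounded_measurable f"
    by (auto simp: bounded_measurable_def)
  have "0 \<le> eigval e \<Lambda> (m + 1)"
    by (simp only: eigval_eq_quadratic_form[OF assms(8)] C_gas_quadratic_form_nonneg[OF assms(7)])
  moreover have "m < CARD('n)"
    using assms(1,10) by simp
  ultimately have "C_gas f $ i $ i \<le> activity_score e U \<Lambda> i m + eigval e \<Lambda> (m + 1)"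
    using assms(2,8) by (intro eigendecomposition_diagonal_le)
  then have "1 / 2 * (C_gas f $ i $ i / cube_variance f)
      \<le> 1 / 2 * ((activity_score e U \<Lambda> i m + eigval e \<Lambda> (m + 1)) / cube_variance f)"
    using assms(6) by (intro mult_left_mono divide_right_mono) auto
  with upper_sobol_index_le_C_gas[OF f assms(7,6), of i] show ?thesis
    by (rule order_trans)
qed

end
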